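(* Let $\operatorname{P}=\operatorname{P}_\theta\in \operatorname{MM}(A,S)$ with parameter vector $\theta=(\theta_F,\theta_V,\theta_{C\setminus V})$, and let $\tilde{\operatorname{P}}=\operatorname{P}_{\tilde\theta}$ be the $\tilde\theta_V$-proportional covariation of $\operatorname{P}$, with parameter vector $\tilde\theta=(\theta_F,\tilde\theta_V,\tilde\theta_{C\setminus V})$. Let $\operatorname{Q}\in L_{\mathrm{sensi}}$ have parameter vector $\bar\theta=(\theta_F,\bar\theta_V,\bar\theta_{C\setminus V})$ (so $\bar\theta_V=\tilde\theta_V$). Then $$\sum_{H\subseteq C,\,H\neq \emptyset}\tilde\theta_{V\cap H}\left(\bar\theta_{(C\setminus V)\cap H}-\tilde\theta_{(C\setminus V)\cap H}\right)\ln\left(\alpha_H\frac{\tilde\theta_{V\cap H}}{\theta_{V\cap H}}\right)\sum_{y\in\mathbb{Y}_H}\theta_{F}^{A_{y,F}}=0,$$ where $$\alpha_H=\prod_{i\in[n]:\,S_i\cap H\neq\emptyset}\ \prod_{j\in (S_i\setminus V)\cap H}\frac{1-|\tilde\theta_{V_i}|}{1-|\theta_{V_i}|},$$ if and only if $$\mathcal D(\operatorname{Q}\|\operatorname{P})=\mathcal D(\operatorname{Q}\|\tilde{\operatorname{P}})+\mathcal D(\tilde{\operatorname{P}}\|\operatorname{P}).$$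
   Context: Notation: $[k]=\{1,\dots,k\}$; $|v|$ is the sum of the entries of a vector $v$; for a finite index set $S$, $\theta_S=(\theta_i)_{i\in S}$; $\Delta_{m-1}$ denotes the set of vectors of length $m$ with strictly positive entries summing to one. Monomial model. $\mathbb Y$ is a finite set with $q$ elements, $A$ is a $q\times k$ matrix of non-negative integers with rows $A_y$, $y\in\mathbb Y$ (no row has all entries equal to $0$ or all entries equal to $1$), and $S=\{S_1,\dots,S_n\}$ is a partition of $[k]$. The parameter space is $\Theta=\prod_{i\in[n]}\Delta_{\#S_i-1}$, i.e. the $\theta\in\mathbb R_{>0}^k$ with $|\theta_{S_i}|=1$ for every $i\in[n]$. For $\theta\in\Theta$ set $\operatorname{P}_\theta(y)=\theta^{A_y}=\prod_{i\in[k]}\theta_i^{A_{y,i}}$. It is assumed that $\sum_{y\in\mathbb Y}\operatorname{P}_\theta(y)=1$ for every $\theta\in\Theta$. The monomial model is $\operatorname{MM}(A,S)=\{\operatorname{P}_\theta:\theta\in\Theta\}$. The model is assumed multilinear ($A$ has entries in $\{0,1\}$) and regular (for all $y\in\mathbb Y$ and $i\in[n]$, $A_{y,j}=1$ for at most one $j\in S_i$). For $B\subseteq[k]$, $\theta_B^{A_{y,B}}=\prod_{i\in B}\theta_i^{A_{y,i}}$. Varied, covaried and fixed parameters. Let $\emptyset\ne V\subset[k]$ and $V_i=V\cap S_i$, with $V_i\subsetneq S_i$ for each $i$. Let $C=\bigcup_{i\in[n]:V_i\neq\emptyset}S_i$ and $F=[k]\setminus C$. Let $\tilde\theta_V$ be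 a vector of positive numbers with $|\tilde\theta_{V_i}|\in(0,1)$ whenever $V_i\neq\emptyset$. Proportional covariation. The $\tilde\theta_V$-proportional covariation of $\operatorname{P}_\theta$ is $\operatorname{P}_{\tilde\theta}$, where on each block $S_i$: if $V_i=\emptyset$ then $\tilde\theta_{S_i}=\theta_{S_i}$; if $V_i\ne\emptyset$ then the entries indexed by $V_i$ are set to $\tilde\theta_{V_i}$ and $\tilde\theta_j=\frac{1-|\tilde\theta_{V_i}|}{1-|\theta_{V_i}|}\theta_j$ for $j\in S_i\setminus V_i$. $L_{\mathrm{sensi}}$ is the set of all densities $\operatorname{P}_{\bar\theta}\in\operatorname{MM}(A,S)$ whose parameter vector satisfies $\bar\theta_F=\theta_F$ and $\bar\theta_V=\tilde\theta_V$ (only the parameters indexed by $C\setminus V$ are free). For $\emptyset\neq H\subseteq C$, $\mathbb{Y}_H=\{y\in\mathbb{Y}: A_{y,i}=1 \text{ for all } i\in H \text{ and } A_{y,i}=0 \text{ for all } i\in C\setminus H\}$; only $H$ with $\mathbb Y_H\neq\emptyset$ contribute to the sum. In the displayed condition, for $B\subseteq[k]$, $\theta_B$ denotes the monomial $\prod_{i\in B}\theta_i$ (equal to $1$ for $B=\emptyset$), and likewise for $\tilde\theta_B$, $\bar\theta_B$; in contrast $|\theta_{V_i}|$ is the sum of the entries of the vector $\theta_{V_i}$. The I-divergence (Kullback-Leibler divergence) is $\mathcal D(\operatorname{Q}\|\operatorname{P})=\sum_{y\in\mathbb Y}\operatorname{Q}(y)\ln\frac{\operatorname{Q}(y)}{\operatorname{P}(y)}$.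 *)

theory Defs
  imports Complex_Main "HOL-Library.FuncSet" "HOL-Library.Disjoint_Sets"
begin

text \<open>
  A vector indexed by a set of coordinates \<open>B \<subseteq> {1..k}\<close> is a function \<open>nat \<Rightarrow> real\<close> of which only the
  values on \<open>B\<close> matter: \<open>sum v B\<close> is the sum of its entries, \<open>prod v B\<close> the product of its entries,
  and vectors are compared pointwise on \<open>B\<close>.  The matrix entry in row \<open>y\<close> and column \<open>j\<close> is \<open>A y j\<close>,
  the blocks of the partition are \<open>S 1, \<dots>, S n\<close>.
\<close>

definition is_partition :: "nat \<Rightarrow> nat \<Rightarrow> (nat \<Rightarrow> nat set) \<Rightarrow> bool" where
  "is_partition k n S \<longleftrightarrow>
     (\<forall>i\<in>{1..n}. S i \<noteq> {}) \<and> disjoint_family_on S {1..n} \<and> (\<Union>i\<in>{1..n}. S i) = {1..k}"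

definition param_space :: "nat \<Rightarrow> nat \<Rightarrow> (nat \<Rightarrow> nat set) \<Rightarrow> (nat \<Rightarrow> real) set" where
  "param_space k n S = {\<theta>. (\<forall>j\<in>{1..k}. 0 < \<theta> j) \<and> (\<forall>i\<in>{1..n}. sum \<theta> (S i) = 1)}"

definition monomial_on :: "('y \<Rightarrow> nat \<Rightarrow> nat) \<Rightarrow> nat set \<Rightarrow> (nat \<Rightarrow> real) \<Rightarrow> 'y \<Rightarrow> real" where
  "monomial_on A B \<theta> y = (\<Prod>i\<in>B. \<theta> i ^ A y i)"

definition density :: "'y set \<Rightarrow> ('y \<Rightarrow> nat \<Rightarrow> nat) \<Rightarrow> nat \<Rightarrow> (nat \<Rightarrow> real) \<Rightarrow> 'y \<Rightarrow> real" where
  "density Y A k \<theta> = (\<lambda>y\<in>Y. monomial_on A {1..k} \<theta> y)"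

definition monomial_model_spec ::
    "'y set \<Rightarrow> ('y \<Rightarrow> nat \<Rightarrow> nat) \<Rightarrow> nat \<Rightarrow> nat \<Rightarrow> (nat \<Rightarrow> nat set) \<Rightarrow> bool" where
  "monomial_model_spec Y A k n S \<longleftrightarrow>
     finite Y \<and>
     is_partition k n S \<and>
     (\<forall>y\<in>Y. (\<exists>j\<in>{1..k}. A y j \<noteq> 0) \<and> (\<exists>j\<in>{1..k}. A y j \<noteq> 1)) \<and>
     (\<forall>\<theta>\<in>param_space k n S. (\<Sum>y\<in>Y. density Y A k \<theta> y) = 1)"

definition MM ::
    "'y set \<Rightarrow> ('y \<Rightarrow> nat \<Rightarrow> nat) \<Rightarrow> nat \<Rightarrow> nat \<Rightarrow> (nat \<Rightarrow> nat set) \<Rightarrow> ('y \<Rightarrow> real) set" where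
  "MM Y A k n S = density Y A k ` param_space k n S"

definition multilinear :: "'y set \<Rightarrow> ('y \<Rightarrow> nat \<Rightarrow> nat) \<Rightarrow> nat \<Rightarrow> bool" where
  "multilinear Y A k \<longleftrightarrow> (\<forall>y\<in>Y. \<forall>j\<in>{1..k}. A y j \<in> {0, 1})"

definition regular ::
    "'y set \<Rightarrow> ('y \<Rightarrow> nat \<Rightarrow> nat) \<Rightarrow> nat \<Rightarrow> (nat \<Rightarrow> nat set) \<Rightarrow> bool" where
  "regular Y A n S \<longleftrightarrow> (\<forall>y\<in>Y. \<forall>i\<in>{1..n}. card {j \<in> S i. A y j = 1} \<le> 1)"

definition covaried_blocks :: "nat \<Rightarrow> (nat \<Rightarrow> nat set) \<Rightarrow> nat set \<Rightarrow> nat set" where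
  "covaried_blocks n S V = (\<Union>i\<in>{i\<in>{1..n}. V \<inter> S i \<noteq> {}}. S i)"

definition admissible_varied :: "nat \<Rightarrow> nat \<Rightarrow> (nat \<Rightarrow> nat set) \<Rightarrow> nat set \<Rightarrow> bool" where
  "admissible_varied k n S V \<longleftrightarrow> V \<noteq> {} \<and> V \<subset> {1..k} \<and> (\<forall>i\<in>{1..n}. V \<inter> S i \<subset> S i)"

definition admissible_values :: "nat \<Rightarrow> (nat \<Rightarrow> nat set) \<Rightarrow> nat set \<Rightarrow> (nat \<Rightarrow> real) \<Rightarrow> bool" where
  "admissible_values n S V v \<longleftrightarrow>
     (\<forall>j\<in>V. 0 < v j) \<and>
     (\<forall>i\<in>{1..n}. V \<inter> S i \<noteq> {} \<longrightarrow> 0 < sum v (V \<inter> S i) \<and> sum v (V \<inter> S i) < 1)"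

definition covar_factor ::
    "(nat \<Rightarrow> nat set) \<Rightarrow> nat set \<Rightarrow> (nat \<Rightarrow> real) \<Rightarrow> (nat \<Rightarrow> real) \<Rightarrow> nat \<Rightarrow> real" where
  "covar_factor S V \<theta> v i = (1 - sum v (V \<inter> S i)) / (1 - sum \<theta> (V \<inter> S i))"

text \<open>
  Parameter vector of the \<open>v\<close>-proportional covariation, where \<open>v\<close> prescribes the entries in \<open>V\<close>.  For
  \<open>j \<in> {1..k}\<close> the definite description below is the unique block containing \<open>j\<close>; see
  \<open>prop_covariation_block\<close> for the blockwise description.
\<close>

definition prop_covariation ::
    "nat \<Rightarrow> (nat \<Rightarrow> nat set) \<Rightarrow> nat set \<Rightarrow> (nat \<Rightarrow> real) \<Rightarrow> (nat \<Rightarrow> real) \<Rightarrow> nat \<Rightarrow> real" where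
  "prop_covariation n S V \<theta> v j =
     (if j \<in> V then v j
      else if j \<in> covaried_blocks n S V
      then covar_factor S V \<theta> v (THE i. i \<in> {1..n} \<and> j \<in> S i) * \<theta> j
      else \<theta> j)"

definition sensi_params ::
    "nat \<Rightarrow> nat \<Rightarrow> (nat \<Rightarrow> nat set) \<Rightarrow> nat set \<Rightarrow> (nat \<Rightarrow> real) \<Rightarrow> (nat \<Rightarrow> real) \<Rightarrow> (nat \<Rightarrow> real) set" where
  "sensi_params k n S V \<theta> v =
     {\<eta> \<in> param_space k n S.
        (\<forall>j\<in>{1..k} - covaried_blocks n S V. \<eta> j = \<theta> j) \<and> (\<forall>j\<in>V. \<eta> j = v j)}"

definition L_sensi ::
    "'y set \<Rightarrow> ('y \<Rightarrow> nat \<Rightarrow> nat) \<Rightarrow> nat \<Rightarrow> nat \<Rightarrow> (nat \<Rightarrow> nat set) \<Rightarrow> nat set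
      \<Rightarrow> (nat \<Rightarrow> real) \<Rightarrow> (nat \<Rightarrow> real) \<Rightarrow> ('y \<Rightarrow> real) set" where
  "L_sensi Y A k n S V \<theta> v = density Y A k ` sensi_params k n S V \<theta> v"

definition Y_fiber ::
    "'y set \<Rightarrow> ('y \<Rightarrow> nat \<Rightarrow> nat) \<Rightarrow> nat \<Rightarrow> (nat \<Rightarrow> nat set) \<Rightarrow> nat set \<Rightarrow> nat set \<Rightarrow> 'y set" where
  "Y_fiber Y A n S V H =
     {y \<in> Y. (\<forall>i\<in>H. A y i = 1) \<and> (\<forall>i\<in>covaried_blocks n S V - H. A y i = 0)}"

definition alpha ::
    "nat \<Rightarrow> (nat \<Rightarrow> nat set) \<Rightarrow> nat set \<Rightarrow> (nat \<Rightarrow> real) \<Rightarrow> (nat \<Rightarrow> real) \<Rightarrow> nat set \<Rightarrow> real" where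
  "alpha n S V \<theta> v H =
     (\<Prod>i\<in>{i\<in>{1..n}. S i \<inter> H \<noteq> {}}. \<Prod>j\<in>(S i - V) \<inter> H. covar_factor S V \<theta> v i)"

definition I_divergence :: "'y set \<Rightarrow> ('y \<Rightarrow> real) \<Rightarrow> ('y \<Rightarrow> real) \<Rightarrow> real" where
  "I_divergence Y Q P = (\<Sum>y\<in>Y. Q y * ln (Q y / P y))"

lemma prop_covariation_block:
  assumes part: "is_partition k n S" and i: "i \<in> {1..n}" and j: "j \<in> S i"
  shows "prop_covariation n S V \<theta> v j =
     (if V \<inter> S i = {} then \<theta> j else if j \<in> V then v j else covar_factor S V \<theta> v i * \<theta> j)"
proof -
  have uniq: "i' = i" if "i' \<in> {1..n}" "j \<in> S i'" for i'
    using part i j that unfolding is_partition_def disjoint_family_on_def by blast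
  have the: "(THE i. i \<in> {1..n} \<and> j \<in> S i) = i"
    using i j uniq by (intro the_equality) blast+
  have "j \<in> covaried_blocks n S V \<longleftrightarrow> V \<inter> S i \<noteq> {}"
    using i j uniq unfolding covaried_blocks_def by blast
  then show ?thesis
    using j unfolding prop_covariation_def the by auto
qed

lemma prop_covariation_in_sensi_params:
  assumes part: "is_partition k n S" and V: "admissible_varied k n S V"
    and v: "admissible_values n S V v" and \<theta>: "\<theta> \<in> param_space k n S"
  shows "prop_covariation n S V \<theta> v \<in> sensi_params k n S V \<theta> v"
proof -
  let ?t = "prop_covariation n S V \<theta> v"
  have un: "(\<Union>i\<in>{1..n}. S i) = {1..k}" using part by (simp add: is_partition_def)
  have fin: "finite (S i)" if "i \<in> {1..n}" for i
    using un that by (metis UN_upper finite_atLeastAtMost finite_subset)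
  have pos: "0 < \<theta> j" if "i \<in> {1..n}" "j \<in> S i" for i j
    using \<theta> un that unfolding param_space_def by blast
  have split: "sum f (S i) = sum f (V \<inter> S i) + sum f (S i - V)" if "i \<in> {1..n}" for f :: "nat \<Rightarrow> real" and i
    using sum.Int_Diff[OF fin[OF that], of f V] by (simp add: Int_commute)
  have rest: "0 < sum \<theta> (S i - V)" "sum \<theta> (S i - V) = 1 - sum \<theta> (V \<inter> S i)" if i: "i \<in> {1..n}" for i
  proof -
    have "S i - V \<noteq> {}" using V i unfolding admissible_varied_def by blast
    then show "0 < sum \<theta> (S i - V)"
      using fin[OF i] pos[OF i] by (intro sum_pos) auto
    show "sum \<theta> (S i - V) = 1 - sum \<theta> (V \<inter> S i)"
      using split[OF i, of \<theta>] \<theta> i by (auto simp: param_space_def)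
  qed
  have block: "?t j = (if V \<inter> S i = {} then \<theta> j else if j \<in> V then v j else covar_factor S V \<theta> v i * \<theta> j)"
    if "i \<in> {1..n}" "j \<in> S i" for i j
    using prop_covariation_block[OF part that] .
  have tpos: "0 < ?t j" if "j \<in> {1..k}" for j
  proof -
    have "j \<in> (\<Union>i\<in>{1..n}. S i)" unfolding un by (rule that)
    then obtain i where i: "i \<in> {1..n}" "j \<in> S i" by (rule UN_E)
    have "0 < 1 - sum v (V \<inter> S i)" if "V \<inter> S i \<noteq> {}"
      using v i(1) that unfolding admissible_values_def by fastforce
    moreover have "0 < 1 - sum \<theta> (V \<inter> S i)"
      using rest(1)[OF i(1)] unfolding rest(2)[OF i(1)] .
    ultimately have "0 < covar_factor S V \<theta> v i" if "V \<inter> S i \<noteq> {}"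
      using that unfolding covar_factor_def by (metis divide_pos_pos)
    moreover have "0 < v j" if "j \<in> V" using v that unfolding admissible_values_def by blast
    ultimately show ?thesis
      unfolding block[OF i] using pos[OF i] by simp
  qed
  have tsum: "sum ?t (S i) = 1" if i: "i \<in> {1..n}" for i
  proof (cases "V \<inter> S i = {}")
    case True
    then have "sum ?t (S i) = sum \<theta> (S i)" using block[OF i] by (intro sum.cong) auto
    then show ?thesis using \<theta> i by (auto simp: param_space_def)
  next
    case False
    have "sum ?t (V \<inter> S i) = sum v (V \<inter> S i)" using block[OF i] by (intro sum.cong) auto
    moreover have "sum ?t (S i - V) = (\<Sum>j\<in>S i - V. covar_factor S V \<theta> v i * \<theta> j)"
      using block[OF i] False by (intro sum.cong) auto
    moreover have "\<dots> = 1 - sum v (V \<inter> S i)"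
      using rest(1)[OF i] unfolding sum_distrib_left[symmetric] rest(2)[OF i] covar_factor_def by simp
    ultimately show ?thesis using split[OF i, of ?t] by simp
  qed
  have "V \<subseteq> (\<Union>i\<in>{1..n}. S i)"
    unfolding un using V by (auto simp: admissible_varied_def)
  then have "V \<subseteq> covaried_blocks n S V"
    unfolding covaried_blocks_def by fastforce
  then have "\<forall>j\<in>{1..k} - covaried_blocks n S V. ?t j = \<theta> j" "\<forall>j\<in>V. ?t j = v j"
    by (auto simp: prop_covariation_def)
  then show ?thesis
    using tpos tsum unfolding sensi_params_def param_space_def by blast
qed

end

theory Submission
  imports Defs
begin

text \<open>
  The defect in the Pythagorean identity is \<open>\<Sum>y. (Q y - Pt y) * ln (Pt y / P y)\<close>.  Group its terms by the
  support \<open>H\<close> of the row of \<open>y\<close> in the covaried columns \<open>C\<close>: by multilinearity each density at \<open>y\<close> is the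
  product of its parameters over \<open>H\<close> times the common factor \<open>\<theta>\<^sub>F\<^bsup>A\<^esup>\<close>.  That factor cancels in the
  logarithm, where proportionality of the covariation leaves \<open>\<alpha>\<^sub>H\<close> and the ratio of the varied
  parameters, and the term \<open>H = {}\<close> vanishes.
\<close>

lemma I_divergence_defect:
  assumes "\<And>y. y \<in> Y \<Longrightarrow> 0 < P y" "\<And>y. y \<in> Y \<Longrightarrow> 0 < R y" "\<And>y. y \<in> Y \<Longrightarrow> 0 < Q y"
  shows "I_divergence Y Q P - (I_divergence Y Q R + I_divergence Y R P) =
    (\<Sum>y\<in>Y. (Q y - R y) * ln (R y / P y))"
  unfolding I_divergence_def sum.distrib[symmetric] sum_subtractf[symmetric]
proof (rule sum.cong)
  fix y assume "y \<in> Y"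
  note pos = assms[OF this]
  \<comment> \<open>By positivity every logarithm of a quotient splits into a difference;
    \<open>ln (Q y)\<close> cancels and \<open>Q y - R y\<close> is left in front of
    \<open>ln (R y) - ln (P y)\<close>.\<close>
  show "Q y * ln (Q y / P y) - (Q y * ln (Q y / R y) + R y * ln (R y / P y)) =
      (Q y - R y) * ln (R y / P y)"
    using pos by (simp add: ln_div algebra_simps)
qed simp

lemma monomial_on_pos:
  assumes "\<And>j. j \<in> B \<Longrightarrow> 0 < \<theta> j"
  shows "0 < monomial_on A B \<theta> y"
  unfolding monomial_on_def using assms by (intro prod_pos) simp

lemma monomial_on_binary:
  assumes "finite B" "\<And>j. j \<in> B \<Longrightarrow> A y j \<in> {0, 1}"
  shows "monomial_on A B \<theta> y = prod \<theta> {j \<in> B. A y j = 1}"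
proof -
  have "monomial_on A B \<theta> y = (\<Prod>j\<in>B. if A y j = 1 then \<theta> j else 1)"
    unfolding monomial_on_def by (rule prod.cong) (use assms(2) in fastforce)+
  then show ?thesis using assms(1) by (simp add: prod.inter_filter)
qed

lemma monomial_on_Un_disjoint:
  assumes "finite B" "finite C" "B \<inter> C = {}"
  shows "monomial_on A (B \<union> C) \<theta> y = monomial_on A B \<theta> y * monomial_on A C \<theta> y"
  unfolding monomial_on_def using assms by (rule prod.union_disjoint)

lemma monomial_on_cong:
  assumes "\<And>j. j \<in> B \<Longrightarrow> \<theta> j = \<eta> j"
  shows "monomial_on A B \<theta> y = monomial_on A B \<eta> y"
  unfolding monomial_on_def using assms by simp

text \<open>Outside \<open>V\<close>, covariation rescales each coordinate of a covaried block by
  the factor of that block. Collecting these factors block by block over \<open>H - V\<close> gives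
  exactly \<open>alpha\<close>.\<close>

lemma prod_prop_covariation:
  assumes part: "is_partition k n S" and H: "H \<subseteq> covaried_blocks n S V"
  shows "prod (prop_covariation n S V \<theta> v) (H - V) = alpha n S V \<theta> v H * prod \<theta> (H - V)"
proof -
  define I where "I = {i \<in> {1..n}. S i \<inter> H \<noteq> {}}"
  have un: "(\<Union>i\<in>{1..n}. S i) = {1..k}" and disj: "disjoint_family_on S {1..n}"
    using part by (simp_all add: is_partition_def)
  have fin: "finite (S i)" if "i \<in> I" for i
  proof (rule finite_subset)
    show "S i \<subseteq> {1..k}" using un that unfolding I_def by blast
  qed simp
  have cover: "H \<subseteq> (\<Union>i\<in>I. S i)"
    using H unfolding I_def covaried_blocks_def by blast
  \<comment> \<open>A point of \<open>H\<close> in \<open>S i\<close> also lies in some covaried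
    block; disjointness identifies the two blocks, so the rescaling case of
    \<open>prop_covariation_block\<close> applies.\<close>
  have covaried: "V \<inter> S i \<noteq> {}" if i: "i \<in> I" for i
  proof -
    obtain j where j: "j \<in> S i" "j \<in> H" using i unfolding I_def by blast
    then obtain i' where i': "i' \<in> {1..n}" "V \<inter> S i' \<noteq> {}" "j \<in> S i'"
      using H unfolding covaried_blocks_def by blast
    then have "i' = i"
      using disj j i unfolding I_def disjoint_family_on_def by blast
    then show ?thesis using i' by simp
  qed
  \<comment> \<open>\<open>I\<close> is the index set used in \<open>alpha\<close>. A block meeting
    \<open>H\<close> only inside \<open>V\<close> contributes an empty product.\<close>
  have decomp: "prod f (H - V) = (\<Prod>i\<in>I. prod f ((S i - V) \<inter> H))" for f :: "nat \<Rightarrow> real"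
  proof -
    have "H - V = (\<Union>i\<in>I. (S i - V) \<inter> H)" using cover by blast
    moreover have "prod f (\<Union>i\<in>I. (S i - V) \<inter> H) = (\<Prod>i\<in>I. prod f ((S i - V) \<inter> H))"
    proof (rule prod.UNION_disjoint)
      show "\<forall>i\<in>I. \<forall>j\<in>I. i \<noteq> j \<longrightarrow> (S i - V) \<inter> H \<inter> ((S j - V) \<inter> H) = {}"
        using disj unfolding I_def disjoint_family_on_def by blast
    qed (use fin in \<open>auto simp: I_def\<close>)
    ultimately show ?thesis by simp
  qed
  have "prod (prop_covariation n S V \<theta> v) ((S i - V) \<inter> H) =
      (\<Prod>j\<in>(S i - V) \<inter> H. covar_factor S V \<theta> v i) * prod \<theta> ((S i - V) \<inter> H)" if "i \<in> I" for i
    unfolding prod.distrib[symmetric]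
  proof (rule prod.cong)
    fix j assume j: "j \<in> (S i - V) \<inter> H"
    have "i \<in> {1..n}" using that by (simp add: I_def)
    then show "prop_covariation n S V \<theta> v j = covar_factor S V \<theta> v i * \<theta> j"
      using prop_covariation_block[OF part, of i j] covaried[OF that] j by simp
  qed simp
  then show ?thesis
    unfolding decomp alpha_def I_def[symmetric] by (simp add: prod.distrib)
qed

text \<open>Only the sums over \<open>V \<inter> S i\<close> of the prescribed values enter the
  factors. Hence the full covaried vector may stand in for \<open>v\<close> inside
  \<open>alpha\<close>.\<close>

lemma alpha_cong:
  assumes "\<And>j. j \<in> V \<Longrightarrow> v j = w j"
  shows "alpha n S V \<theta> v H = alpha n S V \<theta> w H"
proof -
  have "sum v (V \<inter> S i) = sum w (V \<inter> S i)" for i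
    using assms by (intro sum.cong) auto
  then show ?thesis unfolding alpha_def covar_factor_def by simp
qed

text \<open>With entries in {0, 1}, vanishing on \<open>C - H\<close> is the same as not being 1
  there. The fibers thus become level sets of the support map, ready for grouping a sum over
  \<open>Y\<close>.\<close>

lemma Y_fiber_eq:
  assumes "multilinear Y A k" "C = covaried_blocks n S V" "C \<subseteq> {1..k}" "H \<subseteq> C"
  shows "Y_fiber Y A n S V H = {y \<in> Y. {j \<in> C. A y j = 1} = H}"
proof -
  have bin: "A y j = 0 \<longleftrightarrow> A y j \<noteq> 1" if "y \<in> Y" "j \<in> C" for y j
    using assms(1,3) that unfolding multilinear_def by fastforce
  have "(\<forall>i\<in>H. A y i = 1) \<and> (\<forall>i\<in>C - H. A y i = 0) \<longleftrightarrow> {j \<in> C. A y j = 1} = H"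
    if "y \<in> Y" for y
  proof -
    have "(\<forall>i\<in>C - H. A y i = 0) \<longleftrightarrow> (\<forall>i\<in>C - H. A y i \<noteq> 1)"
      using bin[OF that] by (intro ball_cong) auto
    then show ?thesis using assms(4) by blast
  qed
  then show ?thesis unfolding Y_fiber_def assms(2)[symmetric] by blast
qed

theorem theorem3:
  fixes Y :: "'y set" and A :: "'y \<Rightarrow> nat \<Rightarrow> nat" and k n :: nat and S :: "nat \<Rightarrow> nat set"
    and V C F :: "nat set" and v \<theta> \<theta>t \<theta>b :: "nat \<Rightarrow> real" and P Pt Q :: "'y \<Rightarrow> real"
  assumes "monomial_model_spec Y A k n S" and "multilinear Y A k" and "regular Y A n S"
    and "admissible_varied k n S V" and "admissible_values n S V v"
    and "C = covaried_blocks n S V" and "F = {1..k} - C"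
    and "P \<in> MM Y A k n S" and "\<theta> \<in> param_space k n S" and "P = density Y A k \<theta>"
    and "\<theta>t = prop_covariation n S V \<theta> v" and "Pt = density Y A k \<theta>t"
    and "Q \<in> L_sensi Y A k n S V \<theta> v"
    and "\<theta>b \<in> sensi_params k n S V \<theta> v" and "Q = density Y A k \<theta>b"
  shows "(\<Sum>H\<in>{H. H \<subseteq> C \<and> H \<noteq> {}}.
            prod \<theta>t (V \<inter> H) * (prod \<theta>b ((C - V) \<inter> H) - prod \<theta>t ((C - V) \<inter> H))
            * ln (alpha n S V \<theta> \<theta>t H * (prod \<theta>t (V \<inter> H) / prod \<theta> (V \<inter> H)))
            * (\<Sum>y\<in>Y_fiber Y A n S V H. monomial_on A F \<theta> y)) = 0
         \<longleftrightarrow> I_divergence Y Q P = I_divergence Y Q Pt + I_divergence Y Pt P"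
proof -
  have part: "is_partition k n S" and finY: "finite Y"
    using assms(1) by (simp_all add: monomial_model_spec_def)
  then have Ck: "C \<subseteq> {1..k}"
    unfolding \<open>C = _\<close> is_partition_def covaried_blocks_def by blast
  then have finC: "finite C" using finite_subset by blast
  \<comment> \<open>Both \<open>\<theta>t\<close> and \<open>\<theta>b\<close> are members of
    \<open>sensi_params\<close>, so they share the entries of \<open>\<theta>\<close> on
    \<open>F\<close> and those of \<open>v\<close> on \<open>V\<close>.\<close>
  have "\<theta>t \<in> sensi_params k n S V \<theta> v"
    unfolding \<open>\<theta>t = _\<close> using prop_covariation_in_sensi_params[OF part assms(4,5,9)] .
  moreover note \<open>\<theta>b \<in> _\<close> \<open>\<theta> \<in> _\<close>
  ultimately have pos: "\<And>j. j \<in> {1..k} \<Longrightarrow> 0 < \<theta> j" "\<And>j. j \<in> {1..k} \<Longrightarrow> 0 < \<theta>t j"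
      "\<And>j. j \<in> {1..k} \<Longrightarrow> 0 < \<theta>b j"
    and F: "\<And>j. j \<in> F \<Longrightarrow> \<theta>t j = \<theta> j" "\<And>j. j \<in> F \<Longrightarrow> \<theta>b j = \<theta> j"
    and V: "\<And>j. j \<in> V \<Longrightarrow> \<theta>t j = v j" "\<And>j. j \<in> V \<Longrightarrow> \<theta>b j = v j"
    unfolding \<open>F = _\<close> \<open>C = _\<close> by (simp_all add: sensi_params_def param_space_def)
  let ?supp = "\<lambda>y. {j \<in> C. A y j = 1}"
  let ?h = "\<lambda>y. (Q y - Pt y) * ln (Pt y / P y)"
  let ?t = "\<lambda>H. prod \<theta>t (V \<inter> H) * (prod \<theta>b ((C - V) \<inter> H) - prod \<theta>t ((C - V) \<inter> H))
            * ln (alpha n S V \<theta> \<theta>t H * (prod \<theta>t (V \<inter> H) / prod \<theta> (V \<inter> H)))"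
  \<comment> \<open>Agreement with \<open>\<theta>\<close> on \<open>F\<close> suffices, so
    \<open>P\<close>, \<open>Pt\<close> and \<open>Q\<close> all carry the same factor
    \<open>monomial_on A F \<theta> y\<close>.\<close>
  have dens: "density Y A k \<eta> y = prod \<eta> (?supp y) * monomial_on A F \<theta> y"
    if "y \<in> Y" "\<And>j. j \<in> F \<Longrightarrow> \<eta> j = \<theta> j" for \<eta> y
  proof -
    have "{1..k} = C \<union> F" using Ck \<open>F = _\<close> by blast
    then have "density Y A k \<eta> y = monomial_on A C \<eta> y * monomial_on A F \<eta> y"
      using monomial_on_Un_disjoint[of C F A \<eta> y] finC \<open>F = _\<close> that(1) by (auto simp: density_def)
    moreover have "monomial_on A C \<eta> y = prod \<eta> (?supp y)"
      using assms(2) Ck finC that(1) by (intro monomial_on_binary) (auto simp: multilinear_def)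
    moreover have "monomial_on A F \<eta> y = monomial_on A F \<theta> y"
      using that(2) by (rule monomial_on_cong)
    ultimately show ?thesis by simp
  qed
  have dpos: "0 < density Y A k \<eta> y" if "y \<in> Y" "\<And>j. j \<in> {1..k} \<Longrightarrow> 0 < \<eta> j" for \<eta> y
    unfolding density_def using that by (simp del: atLeastAtMost_iff add: monomial_on_pos)
  have h_eq: "?h y = ?t (?supp y) * monomial_on A F \<theta> y" if y: "y \<in> Y" for y
  proof -
    define H where "H = ?supp y"
    define m where "m = monomial_on A F \<theta> y"
    have HC: "H \<subseteq> C" by (auto simp: H_def)
    have "finite H" using HC finC finite_subset by blast
    then have split: "prod \<eta> H = prod \<eta> (V \<inter> H) * prod \<eta> (H - V)" for \<eta> :: "nat \<Rightarrow> real"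
      using prod.Int_Diff[of H \<eta> V] by (simp add: Int_commute)
    have dens_H: "P y = prod \<theta> H * m" "Pt y = prod \<theta>t H * m" "Q y = prod \<theta>b H * m"
      unfolding \<open>P = _\<close> \<open>Pt = _\<close> \<open>Q = density _ _ _ _\<close> H_def m_def
      by (rule dens; use y F in blast)+
    have m: "0 < m" unfolding m_def \<open>F = _\<close> by (intro monomial_on_pos pos) auto
    \<comment> \<open>The product over \<open>H - V\<close> cancels from the ratio and leaves
      \<open>alpha\<close>; positivity of \<open>m\<close> then lets the common factor cancel in
      \<open>Pt y / P y\<close>.\<close>
    have "0 < prod \<theta> (H - V)" using HC Ck pos(1) by (intro prod_pos) blast
    moreover have "prod \<theta>t (H - V) = alpha n S V \<theta> \<theta>t H * prod \<theta> (H - V)"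
      using prod_prop_covariation[OF part, of H V \<theta> v] HC alpha_cong[of V \<theta>t v n S \<theta> H] V(1)
      unfolding \<open>C = _\<close> \<open>\<theta>t = _\<close> by simp
    ultimately have "prod \<theta>t H / prod \<theta> H =
        alpha n S V \<theta> \<theta>t H * (prod \<theta>t (V \<inter> H) / prod \<theta> (V \<inter> H))"
      unfolding split by simp
    then have "Pt y / P y = alpha n S V \<theta> \<theta>t H * (prod \<theta>t (V \<inter> H) / prod \<theta> (V \<inter> H))"
      unfolding dens_H using m by simp
    \<comment> \<open>On \<open>V\<close> both vectors take the prescribed values, so this product
      factors out of \<open>Q y - Pt y\<close>.\<close>
    moreover have "prod \<theta>b (V \<inter> H) = prod \<theta>t (V \<inter> H)"
      by (intro prod.cong) (auto simp: V)
    then have "Q y - Pt y = prod \<theta>t (V \<inter> H) * (prod \<theta>b (H - V) - prod \<theta>t (H - V)) * m"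
      unfolding dens_H split by (simp add: algebra_simps)
    moreover have "(C - V) \<inter> H = H - V" using HC by blast
    ultimately show ?thesis unfolding H_def[symmetric] m_def[symmetric] by simp
  qed
  have "I_divergence Y Q P - (I_divergence Y Q Pt + I_divergence Y Pt P) = sum ?h Y"
    unfolding \<open>P = _\<close> \<open>Pt = _\<close> \<open>Q = density _ _ _ _\<close> by (intro I_divergence_defect dpos pos)
  also have "\<dots> = (\<Sum>H\<in>Pow C. \<Sum>y\<in>{y \<in> Y. ?supp y = H}. ?h y)"
    using finY finC by (intro sum.group[symmetric]) auto
  also have "\<dots> = (\<Sum>H\<in>Pow C. ?t H * (\<Sum>y\<in>Y_fiber Y A n S V H. monomial_on A F \<theta> y))"
  proof (rule sum.cong)
    fix H assume "H \<in> Pow C"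
    then have "Y_fiber Y A n S V H = {y \<in> Y. ?supp y = H}"
      using Y_fiber_eq[OF assms(2,6) Ck] by simp
    then show "(\<Sum>y\<in>{y \<in> Y. ?supp y = H}. ?h y) =
        ?t H * (\<Sum>y\<in>Y_fiber Y A n S V H. monomial_on A F \<theta> y)"
      unfolding sum_distrib_left by (intro sum.cong) (auto simp: h_eq)
  qed simp
  \<comment> \<open>For \<open>H = {}\<close> both products over \<open>(C - V) \<inter> H\<close>
    are empty, so their difference is 1 - 1 = 0.\<close>
  also have "\<dots> = (\<Sum>H\<in>{H. H \<subseteq> C \<and> H \<noteq> {}}. ?t H * (\<Sum>y\<in>Y_fiber Y A n S V H. monomial_on A F \<theta> y))"
    using finC by (intro sum.mono_neutral_right) auto
  finally show ?thesis by linarith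
qed

end
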